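(* Let $(X,\mathcal{A})$ be a measurable space and let $S(X,\mathcal{A})$ be a $\chi$-ring. Let $P$ be a pseudo prime ideal in $S(X,\mathcal{A})$, in the sense that whenever $f,g\in S(X,\mathcal{A})$ satisfy $f\cdot g=0$, then either $f\in P$ or $g\in P$. Then $\mathcal{Z}_S[P]$ is an $\mathcal{A}$-ultrafilter on $X$.
   Context: A measurable space $(X,\mathcal{A})$ is a nonempty set $X$ with a $\sigma$-algebra $\mathcal{A}$ of subsets of $X$. $\mathcal{M}(X,\mathcal{A})$ is the commutative ring (pointwise operations) of all $\mathcal{A}$-measurable functions $X\to\mathbb{R}$. A $\chi$-ring $S(X,\mathcal{A})$ is a subring of $\mathcal{M}(X,\mathcal{A})$ such that $\chi_A\in S(X,\mathcal{A})$ for every $A\in\mathcal{A}$, where $\chi_A$ is the characteristic function of $A$. "Ideal" always means proper ideal. For $f\in S(X,\mathcal{A})$, $\mathcal{Z}_S(f)=\{E\in\mathcal{A}: \text{there exists } g\in S(X,\mathcal{A}) \text{ with } f(x)g(x)=1 \text{ for all } x\in X\setminus E\}$; for an ideal $I$, $\mathcal{Z}_S[I]=\bigcup_{f\in I}\mathcal{Z}_S(f)$. An $\mathcal{A}$-filter on $X$ is a nonempty family of members of $\mathcal{A}$ not containing $\emptyset$, closed under finite intersections and under supersets belonging to $\mathcal{A}$; an $\mathcal{A}$-ultrafilter is a maximal $\mathcal{A}$-filter. *)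

theory Defs
  imports "HOL-Analysis.Borel_Space" "HOL-Algebra.Subrings"
begin

text \<open>A measurable space \<open>(X, \<A>)\<close> is given by a measure-type value \<open>M\<close> with \<open>X = space M\<close> and
  \<open>\<A> = sets M\<close>; its measure component is never used. Functions on \<open>X\<close> are total functions that are
  \<open>extensional\<close> on \<open>space M\<close>, so that equality of ring elements is equality on \<open>X\<close>.\<close>

definition meas_ring :: "'a measure \<Rightarrow> ('a \<Rightarrow> real) ring" where
  "meas_ring M =
    \<lparr>carrier = borel_measurable M \<inter> extensional (space M),
     monoid.mult = (\<lambda>f g. \<lambda>x\<in>space M. f x * g x),
     one = (\<lambda>x\<in>space M. 1),
     ring.zero = (\<lambda>x\<in>space M. 0),
     add = (\<lambda>f g. \<lambda>x\<in>space M. f x + g x)\<rparr>"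

lemma cring_meas_ring: "cring (meas_ring M)"
proof (rule cringI)
  show "abelian_group (meas_ring M)"
  proof (rule abelian_groupI)
    fix f assume "f \<in> carrier (meas_ring M)"
    then show "\<exists>g\<in>carrier (meas_ring M). g \<oplus>\<^bsub>meas_ring M\<^esub> f = \<zero>\<^bsub>meas_ring M\<^esub>"
      by (intro bexI[of _ "\<lambda>x\<in>space M. - f x"])
         (auto simp: meas_ring_def fun_eq_iff cong: measurable_cong)
  qed (auto simp: meas_ring_def fun_eq_iff extensional_def cong: measurable_cong)
  show "comm_monoid (meas_ring M)"
    by (rule comm_monoidI) (auto simp: meas_ring_def fun_eq_iff extensional_def cong: measurable_cong)
qed (auto simp: meas_ring_def fun_eq_iff distrib_right)

definition char_fun :: "'a measure \<Rightarrow> 'a set \<Rightarrow> 'a \<Rightarrow> real" where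
  "char_fun M A = restrict (indicator A) (space M)"

definition chi_ring :: "'a measure \<Rightarrow> ('a \<Rightarrow> real) set \<Rightarrow> bool" where
  "chi_ring M S \<longleftrightarrow> subring S (meas_ring M) \<and> (\<forall>A\<in>sets M. char_fun M A \<in> S)"

abbreviation ring_on :: "'a measure \<Rightarrow> ('a \<Rightarrow> real) set \<Rightarrow> ('a \<Rightarrow> real) ring" where
  "ring_on M S \<equiv> (meas_ring M)\<lparr>carrier := S\<rparr>"

definition proper_ideal :: "'b set \<Rightarrow> ('b, 'c) ring_scheme \<Rightarrow> bool" where
  "proper_ideal I R \<longleftrightarrow> ideal I R \<and> I \<noteq> carrier R"

definition pseudo_prime_ideal :: "'b set \<Rightarrow> ('b, 'c) ring_scheme \<Rightarrow> bool" where
  "pseudo_prime_ideal P R \<longleftrightarrow> proper_ideal P R \<and>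
    (\<forall>f\<in>carrier R. \<forall>g\<in>carrier R. f \<otimes>\<^bsub>R\<^esub> g = \<zero>\<^bsub>R\<^esub> \<longrightarrow> f \<in> P \<or> g \<in> P)"

definition Z_fun :: "'a measure \<Rightarrow> ('a \<Rightarrow> real) set \<Rightarrow> ('a \<Rightarrow> real) \<Rightarrow> 'a set set" where
  "Z_fun M S f = {E \<in> sets M. \<exists>g\<in>S. \<forall>x\<in>space M - E. f x * g x = 1}"

definition Z_ideal :: "'a measure \<Rightarrow> ('a \<Rightarrow> real) set \<Rightarrow> ('a \<Rightarrow> real) set \<Rightarrow> 'a set set" where
  "Z_ideal M S I = (\<Union>f\<in>I. Z_fun M S f)"

definition meas_filter :: "'a measure \<Rightarrow> 'a set set \<Rightarrow> bool" where
  "meas_filter M F \<longleftrightarrow> F \<subseteq> sets M \<and> F \<noteq> {} \<and> {} \<notin> F \<and>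
    (\<forall>A\<in>F. \<forall>B\<in>F. A \<inter> B \<in> F) \<and>
    (\<forall>A\<in>F. \<forall>B\<in>sets M. A \<subseteq> B \<longrightarrow> B \<in> F)"

definition meas_ultrafilter :: "'a measure \<Rightarrow> 'a set set \<Rightarrow> bool" where
  "meas_ultrafilter M F \<longleftrightarrow> meas_filter M F \<and> (\<forall>G. meas_filter M G \<and> F \<subseteq> G \<longrightarrow> G = F)"

end

(* For an ideal I of a chi-ring, a measurable set E lies in Z_S[I] exactly when the characteristic
   function of X - E lies in I: if f g = 1 off E with f in I, multiply f g by that characteristic
   function; conversely an idempotent is its own inverse where it does not vanish. The filter
   axioms are then identities between idempotents, and for complementary sets A, B the product of
   the characteristic functions is 0, so pseudo-primality puts A or B into Z_S[P]. *)

theory Submission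
  imports Defs
begin

lemma Z_ideal_iff:
  assumes chi: "chi_ring M S" and I: "ideal I (ring_on M S)"
  shows "E \<in> Z_ideal M S I \<longleftrightarrow> E \<in> sets M \<and> char_fun M (space M - E) \<in> I"
proof
  assume "E \<in> Z_ideal M S I"
  then obtain f g where E: "E \<in> sets M" and f: "f \<in> I" and g: "g \<in> S"
    and fg: "\<And>x. x \<in> space M - E \<Longrightarrow> f x * g x = 1"
    by (auto simp: Z_ideal_def Z_fun_def)
  let ?c = "char_fun M (space M - E)"
  have c: "?c \<in> S"
    using chi E by (simp add: chi_ring_def)
  \<comment> \<open>On E nothing is known about \<open>f x * g x\<close>, but there
    \<open>?c\<close> vanishes; off E the product is 1. So the multiple of \<open>f\<close> formed
    here is \<open>?c\<close> itself.\<close>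
  have "?c \<otimes>\<^bsub>ring_on M S\<^esub> (g \<otimes>\<^bsub>ring_on M S\<^esub> f) \<in> I"
    using ideal.I_l_closed[OF I] f g c by simp
  also have "?c \<otimes>\<^bsub>ring_on M S\<^esub> (g \<otimes>\<^bsub>ring_on M S\<^esub> f) = ?c"
    using fg by (auto simp: meas_ring_def char_fun_def indicator_def fun_eq_iff mult.commute)
  finally show "E \<in> sets M \<and> ?c \<in> I"
    using E by simp
next
  assume E: "E \<in> sets M \<and> char_fun M (space M - E) \<in> I"
  then have "char_fun M (space M - E) \<in> S"
    using chi by (auto simp: chi_ring_def)
  then have "E \<in> Z_fun M S (char_fun M (space M - E))"
    using E by (auto simp: Z_fun_def char_fun_def intro!: bexI[of _ "char_fun M (space M - E)"])
  then show "E \<in> Z_ideal M S I"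
    using E by (auto simp: Z_ideal_def)
qed

lemma meas_filter_Z_ideal:
  assumes chi: "chi_ring M S" and I: "proper_ideal I (ring_on M S)"
  shows "meas_filter M (Z_ideal M S I)"
proof -
  have idl: "ideal I (ring_on M S)" and proper: "I \<noteq> S"
    using I by (auto simp: proper_ideal_def)
  have char_in: "char_fun M A \<in> S" if "A \<in> sets M" for A
    using chi that by (simp add: chi_ring_def)
  have mult_in: "f \<otimes>\<^bsub>ring_on M S\<^esub> g \<in> I" if "f \<in> S" "g \<in> I" for f g
    using ideal.I_l_closed[OF idl] that by simp
  note Z_iff = Z_ideal_iff[OF chi idl]
  show ?thesis
    unfolding meas_filter_def
  proof (intro conjI ballI impI)
    show "Z_ideal M S I \<subseteq> sets M"
      by (auto simp: Z_iff)
    have "\<zero>\<^bsub>ring_on M S\<^esub> \<in> I"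
      using additive_subgroup.zero_closed[OF ideal.axioms(1)[OF idl]] .
    \<comment> \<open>The empty set is written as a difference to match the right-hand side of
      \<open>Z_iff\<close> at E = X.\<close>
    moreover have "\<zero>\<^bsub>ring_on M S\<^esub> = char_fun M (space M - space M)"
      by (auto simp: meas_ring_def char_fun_def fun_eq_iff)
    ultimately have "space M \<in> Z_ideal M S I"
      unfolding Z_iff by simp
    then show "Z_ideal M S I \<noteq> {}"
      by blast
    \<comment> \<open>If the empty set belonged to the family, the ideal would contain 1 and hence
      be all of \<open>S\<close>.\<close>
    have "char_fun M (space M - {}) = \<one>\<^bsub>ring_on M S\<^esub>"
      by (auto simp: meas_ring_def char_fun_def fun_eq_iff)
    then show "{} \<notin> Z_ideal M S I"
      using ideal.one_imp_carrier[OF idl] proper by (auto simp: Z_iff)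
  next
    fix A B assume A: "A \<in> Z_ideal M S I" and B: "B \<in> Z_ideal M S I"
    \<comment> \<open>The complement of \<open>A \<inter> B\<close> is the disjoint union of X - A
      and A - B, so its characteristic function is a plain sum, with no correction for
      overlap.\<close>
    have "char_fun M (space M - A) \<oplus>\<^bsub>ring_on M S\<^esub>
        (char_fun M A \<otimes>\<^bsub>ring_on M S\<^esub> char_fun M (space M - B)) \<in> I"
      using A B by (intro additive_subgroup.a_closed[OF ideal.axioms(1)[OF idl]] mult_in char_in)
        (simp_all add: Z_iff)
    also have "char_fun M (space M - A) \<oplus>\<^bsub>ring_on M S\<^esub>
        (char_fun M A \<otimes>\<^bsub>ring_on M S\<^esub> char_fun M (space M - B)) = char_fun M (space M - A \<inter> B)"
      by (auto simp: meas_ring_def char_fun_def indicator_def fun_eq_iff)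
    finally show "A \<inter> B \<in> Z_ideal M S I"
      using A B by (simp add: Z_iff sets.Int)
  next
    fix A B assume A: "A \<in> Z_ideal M S I" and B: "B \<in> sets M" and "A \<subseteq> B"
    \<comment> \<open>Since X - B lies inside X - A, multiplying the two characteristic functions
      gives that of X - B.\<close>
    have "char_fun M (space M - B) \<otimes>\<^bsub>ring_on M S\<^esub> char_fun M (space M - A) \<in> I"
      using A B by (intro mult_in char_in) (auto simp: Z_iff)
    also have "char_fun M (space M - B) \<otimes>\<^bsub>ring_on M S\<^esub> char_fun M (space M - A)
        = char_fun M (space M - B)"
      using \<open>A \<subseteq> B\<close> by (auto simp: meas_ring_def char_fun_def indicator_def fun_eq_iff)
    finally show "B \<in> Z_ideal M S I"
      using B by (simp add: Z_iff)
  qed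
qed

text \<open>A filter \<open>G\<close> above \<open>F\<close> with a member A outside
  \<open>F\<close> would also contain the complement of A, taken from \<open>F\<close>, and hence
  the empty set.\<close>

lemma meas_ultrafilterI:
  assumes F: "meas_filter M F"
    and dichotomy: "\<And>A. A \<in> sets M \<Longrightarrow> A \<in> F \<or> space M - A \<in> F"
  shows "meas_ultrafilter M F"
  unfolding meas_ultrafilter_def
proof (intro conjI allI impI)
  fix G assume G: "meas_filter M G \<and> F \<subseteq> G"
  have "A \<in> F" if A: "A \<in> G" for A
  proof (rule ccontr)
    assume "A \<notin> F"
    then have "space M - A \<in> G"
      using G A dichotomy unfolding meas_filter_def by blast
    then have "A \<inter> (space M - A) \<in> G"
      using G A unfolding meas_filter_def by blast
    then show False
      using G by (simp add: meas_filter_def)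
  qed
  then show "G = F"
    using G by blast
qed (rule F)

theorem theorem2p5:
  fixes M :: "'a measure" and S P :: "('a \<Rightarrow> real) set"
  assumes "space M \<noteq> {}"
    and "chi_ring M S"
    and "pseudo_prime_ideal P (ring_on M S)"
  shows "meas_ultrafilter M (Z_ideal M S P)"
proof (rule meas_ultrafilterI)
  have proper: "proper_ideal P (ring_on M S)"
    using assms(3) by (simp add: pseudo_prime_ideal_def)
  show "meas_filter M (Z_ideal M S P)"
    using meas_filter_Z_ideal[OF assms(2) proper] .
  fix A assume A: "A \<in> sets M"
  have "char_fun M A \<otimes>\<^bsub>ring_on M S\<^esub> char_fun M (space M - A) = \<zero>\<^bsub>ring_on M S\<^esub>"
    by (auto simp: meas_ring_def char_fun_def indicator_def fun_eq_iff)
  moreover have "char_fun M A \<in> S" "char_fun M (space M - A) \<in> S"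
    using assms(2) A by (auto simp: chi_ring_def)
  ultimately have "char_fun M A \<in> P \<or> char_fun M (space M - A) \<in> P"
    using assms(3) by (simp add: pseudo_prime_ideal_def)
  \<comment> \<open>\<open>Z_ideal_iff\<close> passes to complements: the characteristic function of
    A in \<open>P\<close> puts X - A into the family, and that of X - A puts A there. The double
    complement is needed for the first case.\<close>
  moreover have "space M - (space M - A) = A"
    using sets.sets_into_space[OF A] by blast
  ultimately show "A \<in> Z_ideal M S P \<or> space M - A \<in> Z_ideal M S P"
    using A proper by (auto simp: proper_ideal_def Z_ideal_iff[OF assms(2)])
qed

end
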